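(* If $\alpha\in(0,1]$, $n\ge1$ and $f\in C^{1,\alpha}(\mathbb{R}^n)$ is non-negative, then $\sqrt f\in C^{\frac{1+\alpha}{2}}(\mathbb{R}^n)$. That is, for any $\alpha\in(0,1]$ and $n\in\mathbb{N}$ we have $m(n,1,\alpha)=1$.
   Context: For $\alpha\in(0,1]$, $C^\alpha(\mathbb{R}^n)$ is the space of functions $f:\mathbb{R}^n\to\mathbb{R}$ with $\sup_{x\ne y}|f(x)-f(y)|/|x-y|^\alpha<\infty$, and $C^{1,\alpha}(\mathbb{R}^n)$ is the space of continuously differentiable functions all of whose first-order partial derivatives lie in $C^\alpha(\mathbb{R}^n)$ (no boundedness of $f$ or $\nabla f$ is required). $m(n,1,\alpha)$ is the supremum, over all $f\in C^{1,\alpha}(\mathbb{R}^n)$ that can be written as a finite sum of squares of functions in $C^{\frac{1+\alpha}{2}}(\mathbb{R}^n)$, of the minimal number of squares of functions in $C^{\frac{1+\alpha}{2}}(\mathbb{R}^n)$ needed to represent $f$. *)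

theory Defs
  imports "HOL-Analysis.Analysis" "HOL-Library.Extended_Nat"
begin

definition holder_space :: "real \<Rightarrow> (real ^ 'n::finite \<Rightarrow> real) set" where
  "holder_space \<alpha> =
     {f. bdd_above {\<bar>f x - f y\<bar> / norm (x - y) powr \<alpha> | x y. x \<noteq> y}}"

definition partial_deriv :: "'n::finite \<Rightarrow> (real ^ 'n \<Rightarrow> real) \<Rightarrow> real ^ 'n \<Rightarrow> real" where
  "partial_deriv i f x = deriv (\<lambda>t. f (x + t *\<^sub>R axis i 1)) 0"

definition C1_holder_space :: "real \<Rightarrow> (real ^ 'n::finite \<Rightarrow> real) set" where
  "C1_holder_space \<alpha> =
     {f. f differentiable_on UNIV \<and>
         (\<forall>i. continuous_on UNIV (partial_deriv i f)) \<and>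
         (\<forall>i. partial_deriv i f \<in> holder_space \<alpha>)}"

definition sum_of_squares :: "real \<Rightarrow> nat \<Rightarrow> (real ^ 'n::finite \<Rightarrow> real) \<Rightarrow> bool" where
  "sum_of_squares \<beta> k f \<longleftrightarrow>
     (\<exists>g :: nat \<Rightarrow> real ^ 'n \<Rightarrow> real.
        (\<forall>j<k. g j \<in> holder_space \<beta>) \<and> (\<forall>x. f x = (\<Sum>j<k. (g j x)\<^sup>2)))"

text \<open>The number \<open>m(n,1,\<alpha>)\<close> with \<open>n = CARD('n)\<close>; the supremum is taken in the extended
  naturals, as it is not finite a priori.  The empty sum is admitted, so the zero function
  needs 0 squares; this does not affect the supremum, since nonzero constants need 1.\<close>

definition m1 :: "'n::finite itself \<Rightarrow> real \<Rightarrow> enat" where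
  "m1 _ \<alpha> =
     (SUP f \<in> {f :: real ^ 'n \<Rightarrow> real.
                 f \<in> C1_holder_space \<alpha> \<and> (\<exists>k. sum_of_squares ((1 + \<alpha>) / 2) k f)}.
        enat (LEAST k. sum_of_squares ((1 + \<alpha>) / 2) k f))"

end

theory Submission
  imports Defs
begin

text \<open>A non-negative \<open>f\<close> with \<open>f y \<le> f x + D (y - x) + C |y - x|\<^bsup>1+\<alpha>\<^esup>\<close> cannot have a steep slope
  where it is small: stepping distance \<open>t\<close> downhill, with \<open>f x = C t\<^bsup>1+\<alpha>\<^esup>\<close>, and using \<open>f \<ge> 0\<close> there
  bounds the slope at \<open>x\<close> by \<open>2 f x / t\<close>. For \<open>|y - x| < t\<close> this controls
  \<open>(f y - f x) / sqrt (f x)\<close>, and for \<open>|y - x| \<ge> t\<close> the value \<open>f y\<close> itself is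
  \<open>O(|y - x|\<^bsup>1+\<alpha>\<^esup>)\<close>.\<close>

lemma holder_spaceI:
  assumes "\<And>x y. \<bar>f x - f y\<bar> \<le> K * norm (x - y) powr \<alpha>"
  shows "f \<in> holder_space \<alpha>"
proof -
  have "\<bar>f x - f y\<bar> / norm (x - y) powr \<alpha> \<le> K" if "x \<noteq> y" for x y
    using assms[of x y] that by (simp add: divide_le_eq)
  then show ?thesis
    unfolding holder_space_def bdd_above_def by blast
qed

lemma holder_spaceE:
  assumes "f \<in> holder_space \<alpha>"
  obtains K where "0 \<le> K" "\<And>x y. \<bar>f x - f y\<bar> \<le> K * norm (x - y) powr \<alpha>"
proof -
  obtain K where K: "\<And>x y. x \<noteq> y \<Longrightarrow> \<bar>f x - f y\<bar> / norm (x - y) powr \<alpha> \<le> K"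
    using assms unfolding holder_space_def bdd_above_def by blast
  \<comment> \<open>Passing to \<open>max K 0\<close> secures the sign of the constant without
    exhibiting two distinct points.\<close>
  have "\<bar>f x - f y\<bar> \<le> max K 0 * norm (x - y) powr \<alpha>" for x y
  proof (cases "x = y")
    case False
    then have "\<bar>f x - f y\<bar> \<le> K * norm (x - y) powr \<alpha>"
      using K[OF False] by (simp add: divide_le_eq)
    also have "\<dots> \<le> max K 0 * norm (x - y) powr \<alpha>"
      by (intro mult_right_mono) auto
    finally show ?thesis .
  qed auto
  then show thesis using that[of "max K 0"] by simp
qed

text \<open>Chain rule along the coordinate lines plus linearity of \<open>D\<close> in the standard
  basis. This is the link that lets bounds on the functions \<open>partial_deriv i f\<close> act on
  the total derivative.\<close>

lemma has_derivative_eq_sum_partial_deriv: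
  fixes f :: "real ^ 'n::finite \<Rightarrow> real"
  assumes D: "(f has_derivative D) (at x)"
  shows "D v = (\<Sum>i\<in>UNIV. v $ i * partial_deriv i f x)"
proof -
  interpret D: bounded_linear D using D by (rule has_derivative_bounded_linear)
  have partial: "partial_deriv i f x = D (axis i 1)" for i
  proof -
    have "((\<lambda>t. f (x + t *\<^sub>R axis i 1)) has_derivative (\<lambda>t. D (t *\<^sub>R axis i 1))) (at 0)"
      by (rule has_derivative_compose[where f = "\<lambda>t. x + t *\<^sub>R axis i 1" and g = f])
        (auto intro!: derivative_eq_intros simp: D)
    then have "((\<lambda>t. f (x + t *\<^sub>R axis i 1)) has_field_derivative D (axis i 1)) (at 0)"
      by (simp add: has_field_derivative_def D.scaleR mult_commute_abs)
    then show ?thesis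
      unfolding partial_deriv_def by (rule DERIV_imp_deriv)
  qed
  have "D v = D (\<Sum>i\<in>UNIV. v $ i *\<^sub>R axis i 1)"
    by (simp add: basis_expansion flip: scalar_mult_eq_scaleR)
  then show ?thesis
    by (simp add: D.sum D.scaleR partial)
qed

text \<open>By the mean value theorem the increment of \<open>f\<close> equals the derivative at
  some point between \<open>x\<close> and \<open>y\<close>; replacing it by the derivative at
  \<open>x\<close> costs a factor of order \<alpha> from the Hoelder bounds on the partials.
  \<open>C\<close> does not depend on \<open>x\<close>, while \<open>D\<close> does.\<close>

lemma C1_holder_space_taylor:
  fixes f :: "real ^ 'n::finite \<Rightarrow> real"
  assumes f: "f \<in> C1_holder_space \<alpha>" and "0 < \<alpha>"
  obtains C where "0 < C"
    "\<And>x. \<exists>D. linear D \<and> (\<forall>y. \<bar>f y - f x - D (y - x)\<bar> \<le> C * norm (y - x) powr (1 + \<alpha>))"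
proof -
  have "\<exists>K. 0 \<le> K \<and>
      (\<forall>x y. \<bar>partial_deriv i f x - partial_deriv i f y\<bar> \<le> K * norm (x - y) powr \<alpha>)" for i
  proof -
    have "partial_deriv i f \<in> holder_space \<alpha>"
      using f by (simp add: C1_holder_space_def)
    then show ?thesis by (elim holder_spaceE) blast
  qed
  then obtain K where K0: "\<And>i. 0 \<le> K i"
    and K: "\<And>i x y. \<bar>partial_deriv i f x - partial_deriv i f y\<bar> \<le> K i * norm (x - y) powr \<alpha>"
    by metis
  have "\<forall>x. \<exists>D. (f has_derivative D) (at x)"
    using f by (simp add: C1_holder_space_def differentiable_on_def differentiable_def)
  then obtain D where D: "\<And>x. (f has_derivative D x) (at x)"
    by metis
  \<comment> \<open>The summand 1 makes \<open>C\<close> strictly positive even if every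
    \<open>K i\<close> is 0, as can happen for affine \<open>f\<close>; the square root estimate
    divides by \<open>C\<close>.\<close>
  define C where "C = 1 + (\<Sum>i\<in>UNIV. K i)"
  have "0 < C"
    unfolding C_def using sum_nonneg[of UNIV K] K0 by (simp add: add_pos_nonneg)
  have "\<bar>f y - f x - D x (y - x)\<bar> \<le> C * norm (y - x) powr (1 + \<alpha>)" for x y
  proof -
    define v where "v = y - x"
    have "\<exists>s\<in>{0<..<1}. f (x + 1 *\<^sub>R v) - f (x + 0 *\<^sub>R v) = D (x + s *\<^sub>R v) ((1 - 0) *\<^sub>R v)"
    proof (rule mvt_simple[where f = "\<lambda>t. f (x + t *\<^sub>R v)" and
          f' = "\<lambda>s t. D (x + s *\<^sub>R v) (t *\<^sub>R v)"])
      show "((\<lambda>t. f (x + t *\<^sub>R v)) has_derivative (\<lambda>t. D (x + s *\<^sub>R v) (t *\<^sub>R v)))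
          (at s within {0..1})" for s :: real
        by (rule has_derivative_compose[where f = "\<lambda>t. x + t *\<^sub>R v" and g = f])
          (auto intro!: derivative_eq_intros simp: D)
    qed simp
    then obtain s where s: "0 < s" "s < 1" and mv: "f y - f x = D (x + s *\<^sub>R v) v"
      by (auto simp: v_def)
    have norm_s: "norm (s *\<^sub>R v) powr \<alpha> \<le> norm v powr \<alpha>"
      using s \<open>0 < \<alpha>\<close> by (intro powr_mono2) (auto simp: mult_left_le_one_le)
    have "\<bar>f y - f x - D x v\<bar>
        = \<bar>\<Sum>i\<in>UNIV. v $ i * (partial_deriv i f (x + s *\<^sub>R v) - partial_deriv i f x)\<bar>"
      unfolding mv has_derivative_eq_sum_partial_deriv[OF D]
      by (simp add: sum_subtractf right_diff_distrib)
    also have "\<dots> \<le> (\<Sum>i\<in>UNIV. \<bar>v $ i * (partial_deriv i f (x + s *\<^sub>R v) - partial_deriv i f x)\<bar>)"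
      by (rule sum_abs)
    also have "\<dots> \<le> (\<Sum>i\<in>UNIV. norm v * (K i * norm v powr \<alpha>))"
    proof (rule sum_mono)
      fix i
      have "\<bar>partial_deriv i f (x + s *\<^sub>R v) - partial_deriv i f x\<bar> \<le> K i * norm (s *\<^sub>R v) powr \<alpha>"
        using K[of i "x + s *\<^sub>R v" x] by simp
      also have "\<dots> \<le> K i * norm v powr \<alpha>"
        using norm_s K0 by (rule mult_left_mono)
      finally show "\<bar>v $ i * (partial_deriv i f (x + s *\<^sub>R v) - partial_deriv i f x)\<bar>
          \<le> norm v * (K i * norm v powr \<alpha>)"
        unfolding abs_mult by (intro mult_mono component_le_norm_cart) auto
    qed
    also have "\<dots> = (\<Sum>i\<in>UNIV. K i) * norm v powr (1 + \<alpha>)"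
      by (cases "v = 0") (simp_all add: powr_add sum_distrib_left sum_distrib_right mult_ac)
    also have "\<dots> \<le> C * norm v powr (1 + \<alpha>)"
      unfolding C_def by (intro mult_right_mono) auto
    finally show ?thesis unfolding v_def .
  qed
  then show thesis
    by (intro that[OF \<open>0 < C\<close>] exI[of _ "D _"] conjI allI has_derivative_linear[OF D])
qed

text \<open>One-sided, since the expansion is assumed only at the base point \<open>x\<close>;
  exchanging the points later gives the absolute value. The constant 3 is generous and serves both
  cases below.\<close>

lemma sqrt_diff_le_of_taylor:
  fixes f :: "'a::real_normed_vector \<Rightarrow> real"
  assumes "0 < \<alpha>" "\<alpha> \<le> 1" "0 < C" and nonneg: "\<And>z. 0 \<le> f z" and "linear D"
    and taylor: "\<And>z. \<bar>f z - f x - D (z - x)\<bar> \<le> C * norm (z - x) powr (1 + \<alpha>)"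
  shows "sqrt (f y) - sqrt (f x) \<le> 3 * sqrt C * norm (y - x) powr ((1 + \<alpha>) / 2)"
proof (cases "y = x")
  case False
  define \<beta> h a b d where "\<beta> = (1 + \<alpha>) / 2" and "h = norm (y - x)"
    and "a = f x" and "b = f y" and "d = D (y - x)"
  have "0 < h" using False by (simp add: h_def)
  have beta: "0 < \<beta>" "\<beta> \<le> 1" using assms by (auto simp: \<beta>_def)
  have nonneg_ab: "0 \<le> a" "0 \<le> b" using nonneg by (auto simp: a_def b_def)
  have square: "r powr (1 + \<alpha>) = (r powr \<beta>)\<^sup>2" for r :: real
    by (simp add: \<beta>_def power2_eq_square flip: powr_add)
  have upper: "b \<le> a + d + C * (h powr \<beta>)\<^sup>2"
    using taylor[of y] by (simp add: a_def b_def d_def h_def square)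
  \<comment> \<open>Expand at the point at distance \<open>t\<close> from \<open>x\<close> in the
    direction away from \<open>y\<close>. There \<open>f\<close> is non-negative and the linear term
    is \<open>- (t / h * d)\<close>, so \<open>d\<close> cannot be large.\<close>
  have slope: "t / h * d \<le> a + C * (t powr \<beta>)\<^sup>2" if "0 < t" for t
  proof -
    have "D (x - (t / h) *\<^sub>R (y - x) - x) = - (t / h * d)"
      using linear_scale[OF \<open>linear D\<close>, of "- (t / h)" "y - x"] by (simp add: d_def)
    moreover have "norm (x - (t / h) *\<^sub>R (y - x) - x) = t"
      using that \<open>0 < h\<close> by (simp flip: h_def)
    ultimately show ?thesis
      using taylor[of "x - (t / h) *\<^sub>R (y - x)"] nonneg[of "x - (t / h) *\<^sub>R (y - x)"]
      by (simp add: a_def square)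
  qed
  have "sqrt b - sqrt a \<le> 3 * sqrt C * h powr \<beta>"
  \<comment> \<open>The threshold compares \<open>h\<close> with the length \<open>t\<close> solving
    \<open>a = C * t powr (1 + \<alpha>)\<close>. If \<open>a\<close> is below it,
    \<open>slope\<close> with step \<open>h\<close> gives
    \<open>d \<le> 2 * C * (h powr \<beta>)\<^sup>2\<close>, and the three terms of
    \<open>upper\<close> add up to the factor 4.\<close>
  proof (cases "a \<le> C * (h powr \<beta>)\<^sup>2")
    case True
    have "d \<le> a + C * (h powr \<beta>)\<^sup>2"
      using slope[OF \<open>0 < h\<close>] \<open>0 < h\<close> by simp
    then have "b \<le> 4 * C * (h powr \<beta>)\<^sup>2"
      using upper True by simp
    also have "\<dots> \<le> (3 * sqrt C * h powr \<beta>)\<^sup>2"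
      using \<open>0 < C\<close> by (simp add: power_mult_distrib)
    finally have "sqrt b \<le> 3 * sqrt C * h powr \<beta>"
      using \<open>0 < C\<close> by (intro real_le_lsqrt) auto
    then show ?thesis using nonneg_ab real_sqrt_ge_zero[of a] by linarith
  next
    case False
    then have "0 < a" using \<open>0 < C\<close> by (smt (verit) mult_nonneg_nonneg zero_le_power2)
    \<comment> \<open>This \<open>t\<close> balances the two terms on the right of
      \<open>slope\<close>: both equal \<open>a\<close>.\<close>
    define t where "t = sqrt (a / C) powr (1 / \<beta>)"
    have "0 < t" using \<open>0 < a\<close> \<open>0 < C\<close> by (simp add: t_def)
    have t_beta: "t powr \<beta> = sqrt (a / C)"
      using beta \<open>0 < a\<close> \<open>0 < C\<close> by (simp add: t_def powr_powr)
    have a_eq: "a = C * (t powr \<beta>)\<^sup>2"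
      using \<open>0 < a\<close> \<open>0 < C\<close> by (simp add: t_beta)
    have sqrt_a: "sqrt a = sqrt C * t powr \<beta>"
      using \<open>0 < C\<close> by (simp add: t_beta real_sqrt_divide)
    have hb_le_tb: "h powr \<beta> \<le> t powr \<beta>"
      using False \<open>0 < C\<close> a_eq by (simp add: not_le)
    then have "h \<le> t"
      using beta \<open>0 < h\<close> \<open>0 < t\<close> powr_less_mono2[of \<beta> t h] by linarith
    define p q where "p = h powr \<beta>" and "q = t powr \<beta>"
    have pq: "0 < p" "p \<le> q" using hb_le_tb \<open>0 < h\<close> by (auto simp: p_def q_def)
    \<comment> \<open>concavity: \<open>r\<^bsup>\<beta>-1\<^esup>\<close> is decreasing in \<open>r\<close>\<close>
    have concave: "h * q \<le> t * p"
    proof -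
      have "t powr (\<beta> - 1) \<le> h powr (\<beta> - 1)"
        using beta \<open>0 < h\<close> \<open>h \<le> t\<close> by (intro powr_mono2') auto
      then show ?thesis
        using \<open>0 < h\<close> \<open>0 < t\<close> by (simp add: p_def q_def powr_diff field_simps)
    qed
    \<comment> \<open>\<open>slope\<close> at the balanced \<open>t\<close> bounds \<open>d\<close>
      by \<open>2 * C * q\<^sup>2 * h / t\<close>; concavity then trades \<open>h * q\<close> for
      \<open>t * p\<close>, leaving only one factor \<open>q\<close>.\<close>
    have "t * d \<le> 2 * C * q\<^sup>2 * h"
      using slope[OF \<open>0 < t\<close>] \<open>0 < h\<close> a_eq by (simp add: q_def field_simps)
    also have "\<dots> \<le> t * (2 * C * p * q)"
      using mult_left_mono[OF concave, of "2 * C * q"] \<open>0 < C\<close> pq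
      by (simp add: power2_eq_square mult_ac)
    finally have "d \<le> 2 * C * p * q"
      using \<open>0 < t\<close> by simp
    moreover have "C * p\<^sup>2 \<le> C * p * q"
      using pq \<open>0 < C\<close> by (simp add: power2_eq_square)
    ultimately have "b \<le> C * q\<^sup>2 + 3 * (C * p * q)"
      using upper a_eq by (simp add: p_def q_def)
    \<comment> \<open>Since \<open>sqrt a = sqrt C * q\<close>, the base of this square is the
      desired bound for \<open>sqrt b\<close>; its cross term \<open>6 * (C * p * q)\<close> absorbs
      the error.\<close>
    also have "\<dots> \<le> (sqrt C * q + 3 * sqrt C * p)\<^sup>2"
    proof -
      have "(sqrt C * q + 3 * sqrt C * p)\<^sup>2 = (sqrt C)\<^sup>2 * (q + 3 * p)\<^sup>2"
        by (simp add: power2_eq_square algebra_simps)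
      also have "\<dots> = C * q\<^sup>2 + 6 * (C * p * q) + 9 * (C * p\<^sup>2)"
        using \<open>0 < C\<close> by (simp add: power2_eq_square algebra_simps)
      finally show ?thesis using pq \<open>0 < C\<close> by simp
    qed
    finally have "sqrt b \<le> sqrt C * q + 3 * sqrt C * p"
      using pq \<open>0 < C\<close> by (intro real_le_lsqrt) auto
    then show ?thesis unfolding sqrt_a p_def q_def by simp
  qed
  then show ?thesis by (simp add: a_def b_def h_def \<beta>_def)
qed simp

text \<open>The Taylor constant is uniform in the base point, so the one-sided estimate holds with
  \<open>x\<close> and \<open>y\<close> in either order.\<close>

lemma sqrt_in_holder_space:
  fixes f :: "real ^ 'n::finite \<Rightarrow> real"
  assumes "0 < \<alpha>" "\<alpha> \<le> 1" and f: "f \<in> C1_holder_space \<alpha>" and nonneg: "\<And>x. 0 \<le> f x"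
  shows "(\<lambda>x. sqrt (f x)) \<in> holder_space ((1 + \<alpha>) / 2)"
proof -
  obtain C where C: "0 < C"
    "\<And>x. \<exists>D. linear D \<and> (\<forall>y. \<bar>f y - f x - D (y - x)\<bar> \<le> C * norm (y - x) powr (1 + \<alpha>))"
    using C1_holder_space_taylor[OF f \<open>0 < \<alpha>\<close>] by blast
  have le: "sqrt (f y) - sqrt (f x) \<le> 3 * sqrt C * norm (y - x) powr ((1 + \<alpha>) / 2)" for x y
    using C(2)[of x] sqrt_diff_le_of_taylor[OF assms(1,2) C(1), of f, OF nonneg] by blast
  show ?thesis
  proof (rule holder_spaceI)
    show "\<bar>sqrt (f x) - sqrt (f y)\<bar> \<le> 3 * sqrt C * norm (x - y) powr ((1 + \<alpha>) / 2)" for x y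
      using le[of x y] le[of y x] by (simp add: norm_minus_commute abs_le_iff)
  qed
qed

lemma const_in_holder_space: "(\<lambda>x. c) \<in> holder_space \<alpha>"
  by (rule holder_spaceI[where K = 0]) simp

lemma const_in_C1_holder_space: "(\<lambda>x :: real ^ 'n::finite. c) \<in> C1_holder_space \<alpha>"
proof -
  have "partial_deriv i (\<lambda>x. c) = (\<lambda>x. 0)" for i :: 'n
    by (simp add: fun_eq_iff partial_deriv_def)
  then show ?thesis
    by (simp add: C1_holder_space_def const_in_holder_space)
qed

text \<open>A sum of squares is non-negative, hence the single square of its root, which bounds the
  supremum by 1. The constant function 1 attains it.\<close>

lemma m1_eq_1:
  assumes "0 < \<alpha>" "\<alpha> \<le> 1"
  shows "m1 TYPE('n::finite) \<alpha> = 1"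
proof -
  let ?S = "sum_of_squares ((1 + \<alpha>) / 2) :: nat \<Rightarrow> (real ^ 'n \<Rightarrow> real) \<Rightarrow> bool"
  let ?F = "{f. f \<in> C1_holder_space \<alpha> \<and> (\<exists>k. ?S k f)}"
  have upper: "enat (LEAST k. ?S k f) \<le> 1" if "f \<in> ?F" for f
  proof -
    have nonneg: "0 \<le> f x" for x
      using that by (auto simp: sum_of_squares_def intro!: sum_nonneg)
    have "(\<lambda>x. sqrt (f x)) \<in> holder_space ((1 + \<alpha>) / 2)"
      using that nonneg assms by (intro sqrt_in_holder_space) auto
    then have "?S 1 f"
      unfolding sum_of_squares_def
      by (intro exI[of _ "\<lambda>_ x. sqrt (f x)"]) (simp add: nonneg)
    then show ?thesis
      by (simp add: one_enat_def Least_le)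
  qed
  have one: "?S 1 (\<lambda>x. 1)"
    unfolding sum_of_squares_def
    by (intro exI[of _ "\<lambda>_ x. 1"]) (simp add: const_in_holder_space)
  \<comment> \<open>With no squares the sum is empty and represents only the zero function.\<close>
  have "\<not> ?S 0 (\<lambda>x. 1)"
    by (simp add: sum_of_squares_def)
  then have "(LEAST k. ?S k (\<lambda>x. 1)) = 1"
    using one by (intro Least_equality) (auto simp: Suc_le_eq intro: gr0I)
  moreover have "(\<lambda>x. 1) \<in> ?F"
    using one const_in_C1_holder_space by blast
  ultimately have "1 \<le> m1 TYPE('n) \<alpha>"
    unfolding m1_def by (intro SUP_upper2[where i = "\<lambda>x. 1"]) (auto simp: one_enat_def)
  moreover have "m1 TYPE('n) \<alpha> \<le> 1"
    unfolding m1_def using upper by (rule SUP_least)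
  ultimately show ?thesis by (rule antisym[rotated])
qed

theorem theorem4:
  fixes \<alpha> :: real
  assumes "0 < \<alpha>" and "\<alpha> \<le> 1"
  shows "(\<forall>f :: real ^ 'n::finite \<Rightarrow> real.
            f \<in> C1_holder_space \<alpha> \<and> (\<forall>x. 0 \<le> f x) \<longrightarrow>
            (\<lambda>x. sqrt (f x)) \<in> holder_space ((1 + \<alpha>) / 2))
         \<and> m1 TYPE('n) \<alpha> = 1"
  using assms sqrt_in_holder_space m1_eq_1 by blast

end
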